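(* Let $M$ be a manifold of dimension $k+1$, let $\omega_0,\ldots,\omega_k$ be a (local) coframe on $M$ and let $\omega(t)=\omega_0+t\omega_1+\cdots+t^k\omega_k$, $t\in\mathbb{R}$. Then the integrability condition $$\omega(t)\wedge d\omega(t)=0$$ is satisfied for any $t$ if and only if it is satisfied for $k+3$ distinct values of $t$.
   Context: For each fixed $t$, $\omega(t)$ is a one-form on $M$ and $d$ is the exterior derivative on $M$. *)

theory Defs
  imports "HOL-Analysis.Analysis"
begin

section \<open>Smooth maps between normed spaces\<close>

text \<open>Both notions are meant for open \<open>S\<close>: \<^const>\<open>frechet_derivative\<close> is taken with respect to the
  full filter \<open>at x\<close>.\<close>

primrec Ck_on :: "nat \<Rightarrow> 'a::real_normed_vector set \<Rightarrow> ('a \<Rightarrow> 'b::real_normed_vector) \<Rightarrow> bool" where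
  "Ck_on 0 S f \<longleftrightarrow> continuous_on S f"
| "Ck_on (Suc n) S f \<longleftrightarrow>
     (\<forall>x\<in>S. f differentiable (at x)) \<and> (\<forall>v. Ck_on n S (\<lambda>x. frechet_derivative f (at x) v))"

definition smooth_on :: "'a::real_normed_vector set \<Rightarrow> ('a \<Rightarrow> 'b::real_normed_vector) \<Rightarrow> bool" where
  "smooth_on S f \<longleftrightarrow> (\<forall>n. Ck_on n S f)"


section \<open>Smooth manifolds\<close>

text \<open>A chart is a domain together with a coordinate map into the model space \<open>'e\<close>. The coordinate
  map is a total function whose values outside of the domain are irrelevant.\<close>

type_synonym ('m, 'e) chart = "'m set \<times> ('m \<Rightarrow> 'e)"

abbreviation chart_dom :: "('m, 'e) chart \<Rightarrow> 'm set" where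
  "chart_dom c \<equiv> fst c"

abbreviation chart_map :: "('m, 'e) chart \<Rightarrow> 'm \<Rightarrow> 'e" where
  "chart_map c \<equiv> snd c"

definition transition :: "('m, 'e) chart \<Rightarrow> ('m, 'e) chart \<Rightarrow> 'e \<Rightarrow> 'e" where
  "transition c d = chart_map d \<circ> inv_into (chart_dom c) (chart_map c)"

text \<open>The atlas \<open>A\<close> is any smooth atlas; it need not be maximal. The dimension of the manifold
  is \<open>DIM('e)\<close>.\<close>

locale smooth_manifold =
  fixes X :: "'m topology" and A :: "('m, 'e::euclidean_space) chart set"
  assumes Hausdorff: "Hausdorff_space X"
    and second_countable: "second_countable X"
    and chart_dom_open: "c \<in> A \<Longrightarrow> openin X (chart_dom c)"
    and chart_image_open: "c \<in> A \<Longrightarrow> open (chart_map c ` chart_dom c)"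
    and chart_homeomorphism: "c \<in> A \<Longrightarrow>
      homeomorphic_map (subtopology X (chart_dom c)) (top_of_set (chart_map c ` chart_dom c))
        (chart_map c)"
    and charts_cover: "(\<Union>c\<in>A. chart_dom c) = topspace X"
    and charts_compatible: "c \<in> A \<Longrightarrow> d \<in> A \<Longrightarrow>
      smooth_on (chart_map c ` (chart_dom c \<inter> chart_dom d)) (transition c d)"


section \<open>Differential forms\<close>

text \<open>A differential form on an open subset \<open>U\<close> of a manifold is a family of forms on the
  coordinate images of \<open>U\<close>, one for each chart of the atlas, which is compatible with pullback
  under the transition maps (as in Bott and Tu, Differential Forms in Algebraic Topology, Section 2).
  If \<open>\<omega>\<close> is a one-form, \<open>\<omega> c x\<close> is the covector of its expression in the chart \<open>c\<close> at the
  coordinate point \<open>x\<close>. Exterior derivative and wedge product commute with pullback and are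
  therefore computed chart by chart.\<close>

type_synonym ('m, 'e) one_form = "('m, 'e) chart \<Rightarrow> 'e \<Rightarrow> ('e \<Rightarrow>\<^sub>L real)"
type_synonym ('m, 'e) two_form = "('m, 'e) chart \<Rightarrow> 'e \<Rightarrow> 'e \<Rightarrow> 'e \<Rightarrow> real"
type_synonym ('m, 'e) three_form = "('m, 'e) chart \<Rightarrow> 'e \<Rightarrow> 'e \<Rightarrow> 'e \<Rightarrow> 'e \<Rightarrow> real"

definition one_form_on ::
  "('m, 'e::euclidean_space) chart set \<Rightarrow> 'm set \<Rightarrow> ('m, 'e) one_form \<Rightarrow> bool" where
  "one_form_on A U \<omega> \<longleftrightarrow>
     (\<forall>c\<in>A. smooth_on (chart_map c ` (chart_dom c \<inter> U)) (\<omega> c)) \<and>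
     (\<forall>c\<in>A. \<forall>d\<in>A. \<forall>x\<in>chart_map c ` (chart_dom c \<inter> chart_dom d \<inter> U). \<forall>v.
        \<omega> c x v = \<omega> d (transition c d x) (frechet_derivative (transition c d) (at x) v))"

text \<open>In coordinates this is \<open>\<Sum>i<j. (\<partial>\<^sub>i \<omega>\<^sub>j - \<partial>\<^sub>j \<omega>\<^sub>i) dx\<^sub>i \<and> dx\<^sub>j\<close>, evaluated on \<open>u\<close> and \<open>v\<close>.\<close>

definition ext_deriv :: "('m, 'e::euclidean_space) one_form \<Rightarrow> ('m, 'e) two_form" where
  "ext_deriv \<omega> = (\<lambda>c x u v.
     blinfun_apply (frechet_derivative (\<omega> c) (at x) u) v -
     blinfun_apply (frechet_derivative (\<omega> c) (at x) v) u)"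

text \<open>The sum over the (1,2)-shuffles, without a combinatorial factor.\<close>

definition wedge :: "('m, 'e::euclidean_space) one_form \<Rightarrow> ('m, 'e) two_form \<Rightarrow> ('m, 'e) three_form"
  where
  "wedge \<alpha> \<beta> = (\<lambda>c x u v w. \<alpha> c x u * \<beta> c x v w - \<alpha> c x v * \<beta> c x u w + \<alpha> c x w * \<beta> c x u v)"

definition vanishes_on ::
  "('m, 'e::euclidean_space) chart set \<Rightarrow> 'm set \<Rightarrow> ('m, 'e) three_form \<Rightarrow> bool" where
  "vanishes_on A U \<eta> \<longleftrightarrow>
     (\<forall>c\<in>A. \<forall>x\<in>chart_map c ` (chart_dom c \<inter> U). \<forall>u v w. \<eta> c x u v w = 0)"

definition integrable_form_on ::
  "('m, 'e::euclidean_space) chart set \<Rightarrow> 'm set \<Rightarrow> ('m, 'e) one_form \<Rightarrow> bool" where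
  "integrable_form_on A U \<omega> \<longleftrightarrow> vanishes_on A U (wedge \<omega> (ext_deriv \<omega>))"

definition local_coframe ::
  "'m topology \<Rightarrow> ('m, 'e::euclidean_space) chart set \<Rightarrow> 'm set \<Rightarrow> nat \<Rightarrow> (nat \<Rightarrow> ('m, 'e) one_form) \<Rightarrow> bool"
  where
  "local_coframe X A U k \<omega> \<longleftrightarrow>
     openin X U \<and>
     (\<forall>i\<le>k. one_form_on A U (\<omega> i)) \<and>
     (\<forall>c\<in>A. \<forall>x\<in>chart_map c ` (chart_dom c \<inter> U).
        inj_on (\<lambda>i. \<omega> i c x) {..k} \<and>
        independent ((\<lambda>i. \<omega> i c x) ` {..k}) \<and>
        span ((\<lambda>i. \<omega> i c x) ` {..k}) = UNIV)"

text \<open>The exterior derivative of \<open>pencil k \<omega> t\<close> is taken on the manifold, for fixed \<open>t\<close>.\<close>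

definition pencil :: "nat \<Rightarrow> (nat \<Rightarrow> ('m, 'e::euclidean_space) one_form) \<Rightarrow> real \<Rightarrow> ('m, 'e) one_form"
  where
  "pencil k \<omega> t = (\<lambda>c x. \<Sum>i\<le>k. t ^ i *\<^sub>R \<omega> i c x)"

end

theory Submission
  imports Defs "HOL-Computational_Algebra.Polynomial"
begin

text \<open>The condition is pointwise and linear in the coefficients: put \<open>\<beta>\<^sub>l = d\<omega>\<^sub>l\<close> at a point, and let
  \<open>e\<^sub>0, \<dots>, e\<^sub>k\<close> be the frame dual to \<open>\<omega>\<^sub>0, \<dots>, \<omega>\<^sub>k\<close>. The kernel of \<open>\<omega>(t)\<close> is spanned by the vectors
  \<open>t e\<^sub>i - e\<^sub>i\<^sub>+\<^sub>1\<close> with \<open>i < k\<close>, and \<open>\<omega>(t) \<and> d\<omega>(t) = 0\<close> says that \<open>d\<omega>(t)\<close> vanishes on this kernel.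
  Although \<open>\<omega>(t) \<and> d\<omega>(t)\<close> has degree \<open>2k\<close> in \<open>t\<close>, the values
  \<open>d\<omega>(t) (t e\<^sub>i - e\<^sub>i\<^sub>+\<^sub>1, t e\<^sub>j - e\<^sub>j\<^sub>+\<^sub>1)\<close> are polynomials in \<open>t\<close> of degree at most \<open>k + 2\<close>, so that
  \<open>k + 3\<close> zeros force them to vanish identically.\<close>

text \<open>Independence yields a functional on the dual space with value 1 at
  \<open>\<alpha> j\<close> and 0 at the other covectors. By reflexivity it is evaluation at a
  vector, which serves as \<open>e j\<close>. Injectivity keeps distinct indices from naming the
  same covector.\<close>

lemma dual_frame_exists:
  fixes \<alpha> :: "'i \<Rightarrow> 'e::euclidean_space \<Rightarrow>\<^sub>L real"
  assumes "inj_on \<alpha> I" and "independent (\<alpha> ` I)"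
  obtains e where "\<And>i j. i \<in> I \<Longrightarrow> j \<in> I \<Longrightarrow> \<alpha> i (e j) = (if i = j then 1 else 0)"
proof -
  have "\<exists>v. \<forall>i\<in>I. \<alpha> i v = (if i = j then 1 else 0)" if "j \<in> I" for j
  proof -
    obtain \<phi> :: "('e \<Rightarrow>\<^sub>L real) \<Rightarrow> real" where "linear \<phi>"
      and \<phi>: "\<And>f. f \<in> \<alpha> ` I \<Longrightarrow> \<phi> f = (if f = \<alpha> j then 1 else 0)"
      using linear_independent_extend[OF assms(2), of "\<lambda>f. if f = \<alpha> j then 1 else 0"] by blast
    interpret \<phi>: linear \<phi> by fact
    let ?v = "\<Sum>b\<in>Basis. \<phi> (blinfun_inner_left b) *\<^sub>R b"
    \<comment> \<open>evaluation at \<open>?v\<close> is \<open>\<phi>\<close>, by reflexivity of finite-dimensional spaces\<close>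
    have "f ?v = \<phi> f" for f :: "'e \<Rightarrow>\<^sub>L real"
    proof -
      have "f = (\<Sum>b\<in>Basis. f b *\<^sub>R blinfun_inner_left b)"
      proof (rule blinfun_eqI)
        fix w
        have "f w = f (\<Sum>b\<in>Basis. (w \<bullet> b) *\<^sub>R b)"
          by (simp add: euclidean_representation)
        then show "f w = (\<Sum>b\<in>Basis. f b *\<^sub>R blinfun_inner_left b) w"
          by (simp add: blinfun.sum_right blinfun.sum_left blinfun.scaleR_right
              blinfun.scaleR_left mult.commute inner_commute)
      qed
      then have "\<phi> f = \<phi> (\<Sum>b\<in>Basis. f b *\<^sub>R blinfun_inner_left b)" by simp
      then show ?thesis
        by (simp add: \<phi>.sum \<phi>.scale blinfun.sum_right blinfun.scaleR_right mult.commute)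
    qed
    then show ?thesis
      using \<phi> that assms(1) by (intro exI[of _ ?v]) (auto simp: inj_on_def)
  qed
  then show thesis using that by metis
qed

text \<open>All \<open>\<alpha> j\<close> agree on both sides. As they span the dual space, every
  covector kills the difference \<open>?w\<close>; pairing \<open>?w\<close> with itself then gives
  \<open>?w = 0\<close>.\<close>

lemma dual_frame_expansion:
  fixes \<alpha> :: "'i \<Rightarrow> 'e::euclidean_space \<Rightarrow>\<^sub>L real"
  assumes "finite I" and "span (\<alpha> ` I) = UNIV"
    and dual: "\<And>i j. i \<in> I \<Longrightarrow> j \<in> I \<Longrightarrow> \<alpha> i (e j) = (if i = j then 1 else 0)"
  shows "u = (\<Sum>i\<in>I. \<alpha> i u *\<^sub>R e i)"
proof -
  let ?w = "u - (\<Sum>i\<in>I. \<alpha> i u *\<^sub>R e i)"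
  have zero: "\<alpha> j ?w = 0" if "j \<in> I" for j
  proof -
    have "(\<Sum>i\<in>I. \<alpha> i u * \<alpha> j (e i)) = (\<Sum>i\<in>I. if i = j then \<alpha> i u else 0)"
      using that by (intro sum.cong) (auto simp: dual)
    then show ?thesis
      using that \<open>finite I\<close>
      by (simp add: blinfun.diff_right blinfun.sum_right blinfun.scaleR_right)
  qed
  have "f ?w = 0" for f :: "'e \<Rightarrow>\<^sub>L real"
  proof -
    have "f \<in> span (\<alpha> ` I)" using assms(2) by simp
    then show ?thesis
      by (induction rule: span_induct_alt)
        (auto simp: blinfun.add_left blinfun.scaleR_left zero)
  qed
  from this[of "blinfun_inner_left ?w"] show ?thesis by simp
qed

text \<open>Modulo \<open>span W\<close>, on which \<beta> vanishes, every \<open>u\<close> is the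
  multiple \<open>\<alpha> c x u *\<^sub>R e\<close>. Hence \<beta> factors at the point as \<alpha>
  \<and> \<theta>, where \<theta> is \<beta> with \<open>e\<close> in its first slot, and \<alpha>
  \<and> \<alpha> \<and> \<theta> = 0.\<close>

lemma wedge_eq_0:
  fixes \<alpha> :: "('m, 'e::euclidean_space) one_form"
  assumes "bilinear (\<beta> c x)" and alt: "\<And>u. \<beta> c x u u = 0"
    and decomp: "\<And>u. u - \<alpha> c x u *\<^sub>R e \<in> span W"
    and zero: "\<And>p q. p \<in> W \<Longrightarrow> q \<in> W \<Longrightarrow> \<beta> c x p q = 0"
  shows "wedge \<alpha> \<beta> c x u v w = 0"
proof -
  let ?b = "\<beta> c x"
  note bil = bilinear_ladd[OF assms(1)] bilinear_radd[OF assms(1)] bilinear_lmul[OF assms(1)]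
    bilinear_rmul[OF assms(1)]
  have span0: "?b p q = 0" if "p \<in> span W" "q \<in> span W" for p q
    using bilinear_eq[OF assms(1), of "\<lambda>_ _. 0" "span W" W "span W" W p q] that zero
    by (auto simp: bilinear_def linear_iff)
  have skew: "?b p e = - ?b e p" for p
    using alt[of "p + e"] unfolding bil by (simp add: alt)
  have expand: "?b p q = \<alpha> c x p * ?b e (q - \<alpha> c x q *\<^sub>R e) - \<alpha> c x q * ?b e (p - \<alpha> c x p *\<^sub>R e)"
    for p q
  proof -
    define p' q' where "p' = p - \<alpha> c x p *\<^sub>R e" and "q' = q - \<alpha> c x q *\<^sub>R e"
    have "?b p q = ?b (\<alpha> c x p *\<^sub>R e + p') (\<alpha> c x q *\<^sub>R e + q')"
      by (simp add: p'_def q'_def)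
    also have "\<dots> = \<alpha> c x p * ?b e q' - \<alpha> c x q * ?b e p' + ?b p' q'"
      unfolding bil by (simp add: alt skew)
    also have "?b p' q' = 0"
      unfolding p'_def q'_def by (intro span0 decomp)
    finally show ?thesis by (simp add: p'_def q'_def)
  qed
  show ?thesis
    unfolding wedge_def expand[of v w] expand[of u w] expand[of u v]
    by (simp add: algebra_simps)
qed

lemma sum_power_mult_quadratic_eq_0:
  fixes a b d :: "nat \<Rightarrow> 'a::idom"
  assumes "card T = k + 3"
    and zero: "\<And>t. t \<in> T \<Longrightarrow> (\<Sum>l\<le>k. t ^ l * (t\<^sup>2 * a l + t * b l + d l)) = 0"
  shows "(\<Sum>l\<le>k. t ^ l * (t\<^sup>2 * a l + t * b l + d l)) = 0"
proof -
  define P where "P = (\<Sum>l\<le>k. monom (a l) (l + 2) + monom (b l) (l + 1) + monom (d l) l)"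
  have P: "poly P s = (\<Sum>l\<le>k. s ^ l * (s\<^sup>2 * a l + s * b l + d l))" for s
    unfolding P_def poly_sum
    by (intro sum.cong) (auto simp: poly_monom algebra_simps power2_eq_square)
  have "degree P \<le> k + 2"
    unfolding P_def
    by (intro degree_sum_le degree_add_le order_trans[OF degree_monom_le]) auto
  moreover have "card T \<le> degree P" if "P \<noteq> 0"
  proof -
    have "T \<subseteq> {s. poly P s = 0}" using zero by (auto simp: P)
    then show ?thesis
      using card_mono[OF poly_roots_finite[OF that]] card_poly_roots_bound[OF that]
      by (meson order_trans)
  qed
  ultimately have "P = 0" using assms(1) by fastforce
  then show ?thesis by (metis P poly_0)
qed

text \<open>The algebraic core, in a single cotangent space: arbitrary alternating bilinear forms
  \<open>\<beta> l\<close> stand in for the exterior derivatives of the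
  \<open>\<omega> l\<close>.\<close>

lemma wedge_pencil_eq_0:
  fixes \<omega> :: "nat \<Rightarrow> ('m, 'e::euclidean_space) one_form"
    and \<beta> :: "nat \<Rightarrow> ('m, 'e) two_form"
    and k :: nat
  defines "\<gamma> \<equiv> \<lambda>t c x u v. \<Sum>l\<le>k. t ^ l * \<beta> l c x u v"
  assumes coframe: "inj_on (\<lambda>i. \<omega> i c x) {..k}" "independent ((\<lambda>i. \<omega> i c x) ` {..k})"
      "span ((\<lambda>i. \<omega> i c x) ` {..k}) = UNIV"
    and bil: "\<And>l. l \<le> k \<Longrightarrow> bilinear (\<beta> l c x)"
    and alt: "\<And>l u. l \<le> k \<Longrightarrow> \<beta> l c x u u = 0"
    and "card T = k + 3"
    and zero: "\<And>t u v w. t \<in> T \<Longrightarrow> wedge (pencil k \<omega> t) (\<gamma> t) c x u v w = 0"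
  shows "wedge (pencil k \<omega> t) (\<gamma> t) c x u v w = 0"
proof -
  obtain e where e: "\<And>i j. i \<le> k \<Longrightarrow> j \<le> k \<Longrightarrow> \<omega> i c x (e j) = (if i = j then 1 else 0)"
    using dual_frame_exists[OF coframe(1,2)] by (metis atMost_iff)
  define f where "f s i = s *\<^sub>R e i - e (Suc i)" for s i
  have pencil_e: "pencil k \<omega> s c x (e j) = s ^ j" if "j \<le> k" for s j
  proof -
    have "(\<Sum>i\<le>k. s ^ i * \<omega> i c x (e j)) = (\<Sum>i\<le>k. if i = j then s ^ i else 0)"
      using that by (intro sum.cong) (auto simp: e)
    then show ?thesis
      using that by (simp add: pencil_def blinfun.sum_left blinfun.scaleR_left)
  qed
  have pencil_f: "pencil k \<omega> s c x (f s i) = 0" if "i < k" for s i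
    using that by (simp add: f_def blinfun.diff_right blinfun.scaleR_right pencil_e)
  have bil_\<gamma>: "bilinear (\<gamma> s c x)" for s
    unfolding \<gamma>_def bilinear_def linear_iff
    by (simp add: bilinear_ladd[OF bil] bilinear_radd[OF bil] bilinear_lmul[OF bil]
        bilinear_rmul[OF bil] sum.distrib sum_distrib_left algebra_simps)
  have f_zero: "\<gamma> t c x (f t i) (f t j) = 0" if "i < k" "j < k" for i j
  proof -
    \<comment> \<open>Each of \<open>f s i\<close> and \<open>f s j\<close> is affine in
      \<open>s\<close>, so bilinearity makes every \<open>\<beta> l c x (f s i) (f s j)\<close>
      quadratic in \<open>s\<close>, with these coefficients.\<close>
    define a where "a l = \<beta> l c x (e i) (e j)" for l
    define b where "b l = - \<beta> l c x (e i) (e (Suc j)) - \<beta> l c x (e (Suc i)) (e j)" for l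
    define d where "d l = \<beta> l c x (e (Suc i)) (e (Suc j))" for l
    have eq: "\<gamma> s c x (f s i) (f s j) = (\<Sum>l\<le>k. s ^ l * (s\<^sup>2 * a l + s * b l + d l))" for s
      unfolding \<gamma>_def f_def
    proof (intro sum.cong refl)
      fix l assume "l \<in> {..k}"
      then have "bilinear (\<beta> l c x)" using bil by simp
      note [simp] = bilinear_lsub[OF this] bilinear_rsub[OF this] bilinear_lmul[OF this]
        bilinear_rmul[OF this]
      show "s ^ l * \<beta> l c x (s *\<^sub>R e i - e (Suc i)) (s *\<^sub>R e j - e (Suc j)) =
          s ^ l * (s\<^sup>2 * a l + s * b l + d l)"
        by (simp add: a_def b_def d_def algebra_simps power2_eq_square)
    qed
    have "\<gamma> s c x (f s i) (f s j) = 0" if "s \<in> T" for s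
      \<comment> \<open>The pencil takes the value \<open>s ^ 0 = 1\<close> at \<open>e 0\<close>,
        also for \<open>s = 0\<close>, and kills the other two vectors, so a single term of the
        wedge product survives.\<close>
      using zero[OF that, of "e 0" "f s i" "f s j"] \<open>i < k\<close> \<open>j < k\<close>
      by (simp add: wedge_def pencil_e pencil_f)
    then show ?thesis
      unfolding eq by (rule sum_power_mult_quadratic_eq_0[OF \<open>card T = k + 3\<close>])
  qed
  have e_mod: "e i - t ^ i *\<^sub>R e 0 \<in> span (f t ` {..<k})" if "i \<le> k" for i
    using that
  proof (induction i)
    case 0
    then show ?case by (simp add: span_zero)
  next
    case (Suc i)
    \<comment> \<open>Since \<open>e (Suc i) = t *\<^sub>R e i - f t i\<close>, this vector is
      \<open>e (Suc i) - t ^ Suc i *\<^sub>R e 0\<close>.\<close>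
    have "t *\<^sub>R (e i - t ^ i *\<^sub>R e 0) - f t i \<in> span (f t ` {..<k})"
      using Suc by (intro span_diff[OF span_scale span_base]) auto
    then show ?case by (simp add: f_def scaleR_diff_right)
  qed
  have decomp: "u - pencil k \<omega> t c x u *\<^sub>R e 0 \<in> span (f t ` {..<k})" for u
  proof -
    \<comment> \<open>In this sum the \<open>e i\<close> add up to \<open>u\<close>, and the total
      coefficient of \<open>e 0\<close> is minus the value of the pencil at
      \<open>u\<close>.\<close>
    have "(\<Sum>i\<le>k. \<omega> i c x u *\<^sub>R (e i - t ^ i *\<^sub>R e 0)) \<in> span (f t ` {..<k})"
      by (intro span_sum span_scale e_mod) simp
    moreover have "(\<Sum>i\<le>k. \<omega> i c x u *\<^sub>R e i) = u"
      by (rule dual_frame_expansion[OF _ coframe(3), symmetric]) (auto simp: e)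
    ultimately show ?thesis
      by (simp add: pencil_def blinfun.sum_left blinfun.scaleR_left scaleR_diff_right
          sum_subtractf scaleR_sum_left mult.commute)
  qed
  show ?thesis
  proof (rule wedge_eq_0)
    show "bilinear (\<gamma> t c x)" by (rule bil_\<gamma>)
    show "u - pencil k \<omega> t c x u *\<^sub>R e 0 \<in> span (f t ` {..<k})" for u by (rule decomp)
    show "\<gamma> t c x u u = 0" for u
      by (simp add: \<gamma>_def alt)
    show "\<gamma> t c x p q = 0" if "p \<in> f t ` {..<k}" "q \<in> f t ` {..<k}" for p q
      using that f_zero by auto
  qed
qed

lemma bilinear_ext_deriv:
  assumes "\<omega> c differentiable at x"
  shows "bilinear (ext_deriv \<omega> c x)"
proof -
  interpret D: linear "frechet_derivative (\<omega> c) (at x)"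
    using assms by (rule linear_frechet_derivative)
  show ?thesis
    unfolding bilinear_def linear_iff ext_deriv_def
    by (simp add: D.add D.scale blinfun.add_left blinfun.add_right blinfun.scaleR_left
        blinfun.scaleR_right algebra_simps)
qed

lemma ext_deriv_pencil:
  assumes "\<And>i. i \<le> k \<Longrightarrow> \<omega> i c differentiable at x"
  shows "ext_deriv (pencil k \<omega> t) c x u v = (\<Sum>i\<le>k. t ^ i * ext_deriv (\<omega> i) c x u v)"
proof -
  have "(pencil k \<omega> t c has_derivative
      (\<lambda>h. \<Sum>i\<le>k. t ^ i *\<^sub>R frechet_derivative (\<omega> i c) (at x) h)) (at x)"
    unfolding pencil_def
    using assms by (auto intro!: derivative_eq_intros simp: frechet_derivative_works)
  then have "frechet_derivative (pencil k \<omega> t c) (at x) =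
      (\<lambda>h. \<Sum>i\<le>k. t ^ i *\<^sub>R frechet_derivative (\<omega> i c) (at x) h)"
    by (rule frechet_derivative_at[symmetric])
  then show ?thesis
    by (simp add: ext_deriv_def blinfun.sum_left blinfun.scaleR_left sum_subtractf
        right_diff_distrib)
qed

lemma one_form_on_imp_differentiable:
  assumes "one_form_on A U \<omega>" and "c \<in> A" and "x \<in> chart_map c ` (chart_dom c \<inter> U)"
  shows "\<omega> c differentiable at x"
proof -
  have "Ck_on (Suc 0) (chart_map c ` (chart_dom c \<inter> U)) (\<omega> c)"
    using assms(1,2) by (simp only: one_form_on_def smooth_on_def)
  then show ?thesis using assms(3) by auto
qed

theorem corollary11p4:
  fixes X :: "'m topology"
    and A :: "('m, 'e::euclidean_space) chart set"
    and U :: "'m set"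
    and k :: nat
    and \<omega> :: "nat \<Rightarrow> ('m, 'e) one_form"
  assumes "smooth_manifold X A"
    and "DIM('e) = k + 1"
    and "local_coframe X A U k \<omega>"
  shows "(\<forall>t::real. integrable_form_on A U (pencil k \<omega> t)) \<longleftrightarrow>
         (\<exists>T::real set. card T = k + 3 \<and> (\<forall>t\<in>T. integrable_form_on A U (pencil k \<omega> t)))"
proof
  assume "\<forall>t::real. integrable_form_on A U (pencil k \<omega> t)"
  moreover obtain T :: "real set" where "card T = k + 3"
    using infinite_arbitrarily_large[OF infinite_UNIV_char_0] by blast
  ultimately show
    "\<exists>T::real set. card T = k + 3 \<and> (\<forall>t\<in>T. integrable_form_on A U (pencil k \<omega> t))"
    by blast
next
  assume "\<exists>T::real set. card T = k + 3 \<and> (\<forall>t\<in>T. integrable_form_on A U (pencil k \<omega> t))"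
  then obtain T :: "real set" where "card T = k + 3"
    and T: "\<And>t. t \<in> T \<Longrightarrow> integrable_form_on A U (pencil k \<omega> t)"
    by blast
  have "wedge (pencil k \<omega> t) (ext_deriv (pencil k \<omega> t)) c x u v w = 0"
    if c: "c \<in> A" and x: "x \<in> chart_map c ` (chart_dom c \<inter> U)" for t c x u v w
  proof -
    have diff: "\<omega> i c differentiable at x" if "i \<le> k" for i
      using assms(3) that c x
      by (auto simp: local_coframe_def intro: one_form_on_imp_differentiable)
    \<comment> \<open>For fixed \<open>s\<close> the powers of \<open>s\<close> are constants on the
      manifold, so the exterior derivative passes through the sum. What remains at \<open>x\<close>
      is pure algebra, and the same \<open>T\<close> serves at every point.\<close>
    have wedge_eq: "wedge (pencil k \<omega> s) (ext_deriv (pencil k \<omega> s)) c x p q r =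
        wedge (pencil k \<omega> s) (\<lambda>c x u v. \<Sum>l\<le>k. s ^ l * ext_deriv (\<omega> l) c x u v) c x p q r"
      for s p q r
      using diff by (simp add: wedge_def ext_deriv_pencil)
    show ?thesis
      unfolding wedge_eq
    proof (rule wedge_pencil_eq_0)
      show "inj_on (\<lambda>i. \<omega> i c x) {..k}" "independent ((\<lambda>i. \<omega> i c x) ` {..k})"
        "span ((\<lambda>i. \<omega> i c x) ` {..k}) = UNIV"
        using assms(3) c x by (auto simp: local_coframe_def)
      show "bilinear (ext_deriv (\<omega> l) c x)" if "l \<le> k" for l
        using that by (intro bilinear_ext_deriv diff)
      show "ext_deriv (\<omega> l) c x u u = 0" for l u
        by (simp add: ext_deriv_def)
      show "card T = k + 3" by fact
      show "wedge (pencil k \<omega> s) (\<lambda>c x u v. \<Sum>l\<le>k. s ^ l * ext_deriv (\<omega> l) c x u v) c x p q r = 0"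
        if "s \<in> T" for s p q r
        using T[OF that] c x
        unfolding wedge_eq[symmetric] integrable_form_on_def vanishes_on_def by blast
    qed
  qed
  then show "\<forall>t::real. integrable_form_on A U (pencil k \<omega> t)"
    by (simp add: integrable_form_on_def vanishes_on_def)
qed

end
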